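(* Let $k$ be a field of characteristic $0$. Then the algebra $$R'=k\langle p,s,q\mid ps=sp+1,\ pqp=p\rangle$$ has a $k$-basis consisting of all words in $p$, $s$ and $q$ in which no $p$ is immediately followed by an $s$, and the $p$'s that occur (if any) form a single consecutive string. In other words, every such word has the form $$s^{a_0}\,q\,s^{a_1}\,q\cdots q\,s^{a_{m-1}}\,q\,s^{a_m}\,p^b\,q\,s^{a_{m+1}}\,q\cdots q\,s^{a_n},$$ where $0\leq m\leq n$, $b\geq 0$, and all $a_i\geq 0$. (If $b=0$, then $m$ is not uniquely defined.)
   Context: $k\langle p,s,q\mid\cdots\rangle$ denotes the associative unital $k$-algebra presented by the generators $p,s,q$ and the indicated relations. That a set of words forms a $k$-basis of $R'$ means that the set maps one-to-one into $R'$ and its image is a $k$-basis of $R'$. The empty word is $1$. *)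

theory Defs
  imports Complex_Main "HOL-Library.Poly_Mapping"
begin

text \<open>
  Words over an alphabet form a monoid under concatenation, written additively with the empty word
  as \<open>0\<close>. With this instance, the convolution product makes \<open>'x list \<Rightarrow>\<^sub>0 'k\<close> the free associative
  unital algebra over \<open>'k\<close> on the alphabet \<open>'x\<close>.
\<close>

instantiation list :: (type) monoid_add
begin

definition zero_list :: "'a list" where "zero_list = []"
definition plus_list :: "'a list \<Rightarrow> 'a list \<Rightarrow> 'a list" where "plus_list u v = u @ v"

instance
  by standard (simp_all add: zero_list_def plus_list_def)

end

definition two_sided_ideal :: "'a::ring_1 set \<Rightarrow> bool" where
  "two_sided_ideal I \<longleftrightarrow> 0 \<in> I \<and> (\<forall>x\<in>I. \<forall>y\<in>I. x + y \<in> I) \<and> (\<forall>a. \<forall>x\<in>I. a * x \<in> I \<and> x * a \<in> I)"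

lemma two_sided_ideal_hull: "two_sided_ideal (two_sided_ideal hull X)"
  by (rule hull_in) (auto simp: two_sided_ideal_def)

datatype gen = Gp | Gs | Gq

definition mon :: "'x list \<Rightarrow> 'x list \<Rightarrow>\<^sub>0 'k::field" where
  "mon w = Poly_Mapping.single w 1"

definition rels :: "(gen list \<Rightarrow>\<^sub>0 'k::field) set" where
  "rels = {mon [Gp, Gs] - (mon [Gs, Gp] + 1), mon [Gp, Gq, Gp] - mon [Gp]}"

definition rel_ideal :: "(gen list \<Rightarrow>\<^sub>0 'k::field) set" where
  "rel_ideal = two_sided_ideal hull rels"

lemma rel_ideal_props:
  shows rel_ideal_0: "0 \<in> rel_ideal"
    and rel_ideal_add: "x \<in> rel_ideal \<Longrightarrow> y \<in> rel_ideal \<Longrightarrow> x + y \<in> rel_ideal"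
    and rel_ideal_mult_left: "x \<in> rel_ideal \<Longrightarrow> a * x \<in> rel_ideal"
    and rel_ideal_mult_right: "x \<in> rel_ideal \<Longrightarrow> x * a \<in> rel_ideal"
  using two_sided_ideal_hull[of rels] unfolding rel_ideal_def two_sided_ideal_def by blast+

lemma rel_ideal_minus: "x \<in> rel_ideal \<Longrightarrow> - x \<in> rel_ideal"
  using rel_ideal_mult_left[of x "- 1"] by simp

lemma rel_ideal_rels: "x \<in> rels \<Longrightarrow> x \<in> rel_ideal"
  unfolding rel_ideal_def using hull_subset[of rels] by blast

definition rel_cong :: "(gen list \<Rightarrow>\<^sub>0 'k::field) \<Rightarrow> (gen list \<Rightarrow>\<^sub>0 'k) \<Rightarrow> bool" where
  "rel_cong x y \<longleftrightarrow> x - y \<in> rel_ideal"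

lemma equivp_rel_cong: "equivp rel_cong"
proof (rule equivpI)
  show "reflp rel_cong"
    by (simp add: reflp_def rel_cong_def rel_ideal_0)
  show "symp rel_cong"
    unfolding symp_def rel_cong_def using rel_ideal_minus by fastforce
  show "transp rel_cong"
    unfolding transp_def rel_cong_def using rel_ideal_add by fastforce
qed

text \<open>The algebra $k\langle p,s,q \mid ps = sp+1,\ pqp = p\rangle$.\<close>

quotient_type (overloaded) 'k ralg = "gen list \<Rightarrow>\<^sub>0 'k::field" / rel_cong
  by (rule equivp_rel_cong)

text \<open>
  Only the classes \<open>ring\<close> and \<open>monoid_mult\<close> are instantiated: \<open>ring_1\<close> would additionally
  require \<open>0 \<noteq> 1\<close>, which is not immediate from the presentation.
\<close>

instantiation ralg :: (field) "{ring, monoid_mult}"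
begin

lift_definition zero_ralg :: "'a ralg" is 0 .
lift_definition one_ralg :: "'a ralg" is 1 .
lift_definition plus_ralg :: "'a ralg \<Rightarrow> 'a ralg \<Rightarrow> 'a ralg" is "(+)"
  unfolding rel_cong_def by (metis add_diff_add rel_ideal_add)
lift_definition uminus_ralg :: "'a ralg \<Rightarrow> 'a ralg" is uminus
  unfolding rel_cong_def by (metis minus_diff_minus rel_ideal_minus)
lift_definition minus_ralg :: "'a ralg \<Rightarrow> 'a ralg \<Rightarrow> 'a ralg" is "(-)"
proof -
  fix x x' y y' :: "gen list \<Rightarrow>\<^sub>0 'a"
  assume "rel_cong x x'" "rel_cong y y'"
  then have "(x - x') + - (y - y') \<in> rel_ideal"
    unfolding rel_cong_def by (intro rel_ideal_add rel_ideal_minus)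
  then show "rel_cong (x - y) (x' - y')"
    by (simp add: rel_cong_def algebra_simps)
qed
lift_definition times_ralg :: "'a ralg \<Rightarrow> 'a ralg \<Rightarrow> 'a ralg" is "(*)"
proof -
  fix x x' y y' :: "gen list \<Rightarrow>\<^sub>0 'a"
  assume "rel_cong x x'" "rel_cong y y'"
  then have "(x - x') * y + x' * (y - y') \<in> rel_ideal"
    unfolding rel_cong_def by (intro rel_ideal_add rel_ideal_mult_left rel_ideal_mult_right)
  then show "rel_cong (x * y) (x' * y')"
    by (simp add: rel_cong_def algebra_simps)
qed

instance
  by standard
    (transfer, simp add: algebra_simps rel_cong_def rel_ideal_0)+

end

lemma word_poly_induct [case_names zero add]:
  fixes x :: "'x list \<Rightarrow>\<^sub>0 'k::field"
  assumes "P 0" and "\<And>w c x. P x \<Longrightarrow> P (Poly_Mapping.single w c + x)"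
  shows "P x"
proof (induction x rule: update_induct)
  case const
  show ?case by (rule assms)
next
  case (update f a b)
  have "Poly_Mapping.update a b f = Poly_Mapping.single a b + f"
    using update(1)
    by (intro poly_mapping_eqI)
      (auto simp: lookup_update lookup_add lookup_single when_def in_keys_iff)
  with update show ?case by (simp add: assms)
qed

lemma map_mult_add:
  "Poly_Mapping.map ((*) c) (x + y) = Poly_Mapping.map ((*) c) x + Poly_Mapping.map ((*) c) y"
  for x :: "'x list \<Rightarrow>\<^sub>0 'k::field"
  by transfer (auto simp: when_def fun_eq_iff distrib_left add_eq_0_iff)

lemma map_mult_eq: "Poly_Mapping.map ((*) c) x = Poly_Mapping.single 0 c * x"
  for x :: "'x list \<Rightarrow>\<^sub>0 'k::field"
proof (induction x rule: word_poly_induct)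
  case zero
  show ?case by (simp add: map_eq_zero_iff)
next
  case (add w d x)
  then show ?case by (simp add: map_mult_add distrib_left mult_single)
qed

lemma single_central: "x * Poly_Mapping.single 0 c = Poly_Mapping.single 0 c * x"
  for x :: "'x list \<Rightarrow>\<^sub>0 'k::field"
  by (induction x rule: word_poly_induct)
    (simp_all add: distrib_left distrib_right mult_single mult.commute)

lift_definition ralg_scale :: "'k::field \<Rightarrow> 'k ralg \<Rightarrow> 'k ralg" is "\<lambda>c. Poly_Mapping.map ((*) c)"
  unfolding map_mult_eq rel_cong_def
  by (metis right_diff_distrib rel_ideal_mult_left)

lemma rel_cong_eqI: "x = y \<Longrightarrow> rel_cong x y"
  by (simp add: rel_cong_def rel_ideal_0)

global_interpretation ralg: vector_space "ralg_scale :: 'k::field \<Rightarrow> 'k ralg \<Rightarrow> 'k ralg"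
proof
  fix a b :: 'k and x y :: "'k ralg"
  show "ralg_scale a (x + y) = ralg_scale a x + ralg_scale a y"
    by transfer (rule rel_cong_eqI, simp only: map_mult_eq distrib_left)
  show "ralg_scale (a + b) x = ralg_scale a x + ralg_scale b x"
    by transfer (rule rel_cong_eqI, simp only: map_mult_eq single_add distrib_right)
  show "ralg_scale a (ralg_scale b x) = ralg_scale (a * b) x"
    by transfer (rule rel_cong_eqI, simp add: map_mult_eq mult.assoc[symmetric] mult_single)
  show "ralg_scale 1 x = x"
    by transfer (rule rel_cong_eqI, simp add: map_mult_eq)
qed

lemma ralg_scale_mult_left: "ralg_scale c x * y = ralg_scale c (x * y)"
  by transfer (rule rel_cong_eqI, simp only: map_mult_eq mult.assoc)

lemma ralg_scale_mult_right: "x * ralg_scale c y = ralg_scale c (x * y)"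
  by transfer (rule rel_cong_eqI, metis map_mult_eq mult.assoc single_central)

lift_definition ralg_gen :: "gen \<Rightarrow> 'k::field ralg" is "\<lambda>g. mon [g]" .

lemma ralg_rel_ps: "ralg_gen Gp * ralg_gen Gs = ralg_gen Gs * ralg_gen Gp + 1"
  by transfer (auto simp: rel_cong_def mon_def mult_single plus_list_def rels_def intro!: rel_ideal_rels)

lemma ralg_rel_pqp: "ralg_gen Gp * ralg_gen Gq * ralg_gen Gp = ralg_gen Gp"
  by transfer (auto simp: rel_cong_def mon_def mult_single plus_list_def rels_def intro!: rel_ideal_rels)

definition ralg_word :: "gen list \<Rightarrow> 'k::field ralg" where
  "ralg_word w = prod_list (map ralg_gen w)"

lemma ralg_word_eq: "ralg_word w = abs_ralg (mon w)"
proof (induction w)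
  case Nil
  have "(1 :: 'a ralg) = abs_ralg (mon [])"
    by (simp add: one_ralg_def mon_def zero_list_def[symmetric])
  then show ?case
    by (simp add: ralg_word_def)
next
  case (Cons g w)
  have "mon [g] * mon w = (mon (g # w) :: gen list \<Rightarrow>\<^sub>0 'a)"
    by (simp add: mon_def mult_single plus_list_def)
  with Cons show ?case
    by (simp add: ralg_word_def ralg_gen.abs_eq times_ralg.abs_eq)
qed

definition basis_words :: "gen list set" where
  "basis_words = {w. (\<nexists>u v. w = u @ [Gp, Gs] @ v) \<and>
     (\<exists>u b v. w = u @ replicate b Gp @ v \<and> Gp \<notin> set u \<and> Gp \<notin> set v)}"

text \<open>
  The word $s^{a_0} q s^{a_1} \cdots q s^{a_m}\, p^b\, q s^{a_{m+1}} \cdots q s^{a_n}$; for $m = n$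
  nothing follows $p^b$.
\<close>

definition form_word :: "(nat \<Rightarrow> nat) \<Rightarrow> nat \<Rightarrow> nat \<Rightarrow> nat \<Rightarrow> gen list" where
  "form_word a m n b =
     replicate (a 0) Gs @ concat (map (\<lambda>i. Gq # replicate (a i) Gs) [1..<m + 1]) @
     replicate b Gp @ concat (map (\<lambda>i. Gq # replicate (a i) Gs) [m + 1..<n + 1])"

end

(*
  The free algebra A is made into a left R'-module: s and q act by left multiplication, and p by an
  operator P chosen so that every basis word w sends 1 to w; this gives linear independence.
  The defining relations make (1 - pq) x (1 - qp) = 0 for all x (this uses characteristic 0, because
  s^k = (p s^(k+1) - s^(k+1) p) / (k+1)). Hence on (1 - pq) R' right multiplication by p is induced
  by the operator d on A with d(1) = 0, d(xq) = x, d(xs) = d(x) s - x. Writing rho(w) for the result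
  of applying the letters of w to 1 on the right, with p acting as d, it follows that
  pqw = w - rho(w) + pq rho(w), where rho(w) contains no p. This formula straightens products with p
  and also serves as the definition of P(qw). The relation pqp = p holds for P because rho(P w) = 0.
*)
theory Submission
  imports Defs
begin

section \<open>Linear operators on the free algebra\<close>

lemma mon_mult: "mon u * mon v = mon (u @ v)"
  by (simp add: mon_def mult_single plus_list_def)

lemma mon_Nil: "mon [] = 1"
  by (simp add: mon_def zero_list_def[symmetric])

lemma single_eq_mon: "Poly_Mapping.single w c = Poly_Mapping.single 0 c * mon w"
  by (simp add: mon_def mult_single)

lemma keys_mon [simp]: "Poly_Mapping.keys (mon w :: _ \<Rightarrow>\<^sub>0 'k::field) = {w}"
  by (simp add: mon_def)

lemma keys_mon_mult:
  "Poly_Mapping.keys (mon u * x) \<subseteq> (@) u ` Poly_Mapping.keys x"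
  for x :: "_ \<Rightarrow>\<^sub>0 'k::field"
  using keys_mult[of "mon u" x] by (auto simp: plus_list_def)

lemma keys_mult_mon:
  "Poly_Mapping.keys (x * mon u) \<subseteq> (\<lambda>w. w @ u) ` Poly_Mapping.keys x"
  for x :: "_ \<Rightarrow>\<^sub>0 'k::field"
  using keys_mult[of x "mon u"] by (auto simp: plus_list_def)

lemma keys_subset_add:
  "Poly_Mapping.keys x \<subseteq> S \<Longrightarrow> Poly_Mapping.keys y \<subseteq> S \<Longrightarrow> Poly_Mapping.keys (x + y) \<subseteq> S"
  using keys_add[of x y] by blast

lemma keys_subset_diff:
  "Poly_Mapping.keys x \<subseteq> S \<Longrightarrow> Poly_Mapping.keys y \<subseteq> S \<Longrightarrow> Poly_Mapping.keys (x - y) \<subseteq> S"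
  for x y :: "_ \<Rightarrow>\<^sub>0 'k::ab_group_add"
  unfolding subset_iff in_keys_iff lookup_minus by (metis diff_zero)

lemma keys_subset_scalar:
  "Poly_Mapping.keys x \<subseteq> S \<Longrightarrow> Poly_Mapping.keys (Poly_Mapping.single 0 c * x) \<subseteq> S"
  for x :: "'x list \<Rightarrow>\<^sub>0 'k::field"
  using keys_mult[of "Poly_Mapping.single 0 c" x] by (auto split: if_splits)

lemma keys_subset_induct [consumes 1, case_names zero add]:
  fixes x :: "'x list \<Rightarrow>\<^sub>0 'k::field"
  assumes "Poly_Mapping.keys x \<subseteq> S"
    and "P 0" and "\<And>w c y. w \<in> S \<Longrightarrow> P y \<Longrightarrow> P (Poly_Mapping.single 0 c * mon w + y)"
  shows "P x"
  using assms(1)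
proof (induction x rule: update_induct)
  case const
  show ?case by (rule assms)
next
  case (update f a b)
  have "Poly_Mapping.update a b f = Poly_Mapping.single 0 b * mon a + f"
    using update(1)
    by (intro poly_mapping_eqI)
      (auto simp: single_eq_mon[symmetric] lookup_update lookup_add lookup_single when_def in_keys_iff)
  moreover have "a \<in> S" "Poly_Mapping.keys f \<subseteq> S"
    using update by (simp_all add: keys_update)
  ultimately show ?case using update by (simp add: assms(3))
qed

text \<open>A scalar c is represented by \<open>single 0 c\<close>, the multiple c of the empty
  word, so homogeneity is phrased through ring multiplication.\<close>

definition is_lin :: "(('x list \<Rightarrow>\<^sub>0 'k::field) \<Rightarrow> ('y list \<Rightarrow>\<^sub>0 'k)) \<Rightarrow> bool" where
  "is_lin T \<longleftrightarrow> (\<forall>x y. T (x + y) = T x + T y) \<and>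
     (\<forall>c x. T (Poly_Mapping.single 0 c * x) = Poly_Mapping.single 0 c * T x)"

lemma is_lin_add: "is_lin T \<Longrightarrow> T (x + y) = T x + T y"
  and is_lin_scalar: "is_lin T \<Longrightarrow> T (Poly_Mapping.single 0 c * x) = Poly_Mapping.single 0 c * T x"
  by (simp_all add: is_lin_def)

lemma is_lin_zero: "is_lin T \<Longrightarrow> T 0 = 0"
  using is_lin_add[of T 0 0] by simp

lemma is_lin_diff: "is_lin T \<Longrightarrow> T (x - y) = T x - T y"
  using is_lin_add[of T "x - y" y] by (simp add: algebra_simps)

lemma is_lin_eq_on:
  assumes "Poly_Mapping.keys x \<subseteq> S" "is_lin T" "is_lin U" "\<And>w. w \<in> S \<Longrightarrow> T (mon w) = U (mon w)"
  shows "T x = U x"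
  using assms(1)
  by (induction x rule: keys_subset_induct)
    (simp_all add: assms is_lin_zero is_lin_add is_lin_scalar)

lemma is_lin_eq:
  assumes "is_lin T" "is_lin U" "\<And>w. T (mon w) = U (mon w)"
  shows "T x = U x"
  using is_lin_eq_on[OF subset_UNIV assms(1,2)] assms(3) by blast

lemma is_lin_keys_subset:
  assumes "Poly_Mapping.keys x \<subseteq> S" "is_lin T"
    and "\<And>w. w \<in> S \<Longrightarrow> Poly_Mapping.keys (T (mon w)) \<subseteq> S'"
  shows "Poly_Mapping.keys (T x) \<subseteq> S'"
  using assms(1)
  by (induction x rule: keys_subset_induct)
    (simp_all add: assms is_lin_zero is_lin_add is_lin_scalar keys_subset_add keys_subset_scalar)

named_theorems is_lin_intros

lemma is_lin_id [is_lin_intros]: "is_lin (\<lambda>x. x)"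
  by (simp add: is_lin_def)

lemma is_lin_plus [is_lin_intros]: "is_lin T \<Longrightarrow> is_lin U \<Longrightarrow> is_lin (\<lambda>x. T x + U x)"
  by (simp add: is_lin_def algebra_simps)

lemma is_lin_minus [is_lin_intros]: "is_lin T \<Longrightarrow> is_lin U \<Longrightarrow> is_lin (\<lambda>x. T x - U x)"
  by (simp add: is_lin_def algebra_simps)

lemma is_lin_mult_left [is_lin_intros]: "is_lin T \<Longrightarrow> is_lin (\<lambda>x. a * T x)"
  unfolding is_lin_def by (metis distrib_left mult.assoc single_central)

lemma is_lin_mult_right [is_lin_intros]: "is_lin T \<Longrightarrow> is_lin (\<lambda>x. T x * a)"
  by (simp add: is_lin_def distrib_right mult.assoc)

lemma is_lin_comp: "is_lin T \<Longrightarrow> is_lin U \<Longrightarrow> is_lin (\<lambda>x. T (U x))"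
  by (simp add: is_lin_def)

definition lin_ext :: "('x list \<Rightarrow> ('y list \<Rightarrow>\<^sub>0 'k::field)) \<Rightarrow> ('x list \<Rightarrow>\<^sub>0 'k) \<Rightarrow> ('y list \<Rightarrow>\<^sub>0 'k)" where
  "lin_ext f x =
     (\<Sum>w\<in>Poly_Mapping.keys x. Poly_Mapping.single 0 (Poly_Mapping.lookup x w) * f w)"

lemma lin_ext_mon [simp]: "lin_ext f (mon w) = f w"
  by (simp add: lin_ext_def mon_def)

lemma is_lin_lin_ext [is_lin_intros]:
  assumes "is_lin T"
  shows "is_lin (\<lambda>x. lin_ext f (T x))"
proof -
  have add: "lin_ext f (x + y) = lin_ext f x + lin_ext f y" for x y
    unfolding lin_ext_def
    by (rule setsum_keys_plus_distrib) (simp_all add: single_add distrib_right)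
  have "lin_ext f (Poly_Mapping.single 0 c * x) = Poly_Mapping.single 0 c * lin_ext f x" for c x
  proof (induction x rule: word_poly_induct)
    case zero
    show ?case by (simp add: lin_ext_def)
  next
    case (add w d x)
    have "lin_ext f (Poly_Mapping.single w e) = Poly_Mapping.single 0 e * f w" for e
      by (simp add: lin_ext_def)
    with add show ?case
      by (simp add: \<open>\<And>x y. lin_ext f (x + y) = _\<close> distrib_left mult_single mult.assoc[symmetric])
  qed
  with add assms show ?thesis
    by (simp add: is_lin_def)
qed

section \<open>A right action on the free algebra\<close>

text \<open>
  Words are read from the right, so the argument is the reversed word. The clause for \<open>Gp\<close> only
  serves to make \<open>rderiv_mult\<close> below hold without restricting to words free of \<open>Gp\<close>.
\<close>

fun deriv_rev :: "gen list \<Rightarrow> (gen list \<Rightarrow>\<^sub>0 'k::field)" where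
  "deriv_rev [] = 0"
| "deriv_rev (Gq # u) = mon (rev u)"
| "deriv_rev (Gs # u) = deriv_rev u * mon [Gs] - mon (rev u)"
| "deriv_rev (Gp # u) = deriv_rev u * mon [Gp]"

text \<open>This is the operator d. It models right multiplication by p on (1 - pq) R', where qp
  acts as 1 and sp as ps - 1.\<close>

definition rderiv :: "(gen list \<Rightarrow>\<^sub>0 'k::field) \<Rightarrow> (gen list \<Rightarrow>\<^sub>0 'k)" where
  "rderiv = lin_ext (\<lambda>w. deriv_rev (rev w))"

lemma is_lin_rderiv [is_lin_intros]: "is_lin T \<Longrightarrow> is_lin (\<lambda>x. rderiv (T x))"
  unfolding rderiv_def by (rule is_lin_lin_ext)

lemmas is_lin_rderiv_id = is_lin_rderiv[OF is_lin_id]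

lemma rderiv_1 [simp]: "rderiv 1 = 0"
  by (simp add: rderiv_def mon_Nil[symmetric])

lemma rderiv_q [simp]: "rderiv (x * mon [Gq]) = x"
  by (rule is_lin_eq[where x = x]) (auto intro!: is_lin_intros simp: mon_mult rderiv_def)

lemma rderiv_s: "rderiv (x * mon [Gs]) = rderiv x * mon [Gs] - x"
  by (rule is_lin_eq[where x = x]) (auto intro!: is_lin_intros simp: mon_mult rderiv_def)

lemma rderiv_p: "rderiv (x * mon [Gp]) = rderiv x * mon [Gp]"
  by (rule is_lin_eq[where x = x]) (auto intro!: is_lin_intros simp: mon_mult rderiv_def)

text \<open>The rules for d touch only the last letter, so a left factor g passes through them; the
  induction starts because d(g) = 0 = g d(1).\<close>

lemma rderiv_mult:
  assumes "rderiv g = 0"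
  shows "rderiv (g * x) = g * rderiv x"
proof (rule is_lin_eq[where x = x])
  show "rderiv (g * mon w) = g * rderiv (mon w)" for w
  proof (induction w rule: rev_induct)
    case Nil
    then show ?case by (simp add: mon_Nil assms)
  next
    case (snoc a w)
    have *: "mon (w @ [a]) = mon w * (mon [a] :: gen list \<Rightarrow>\<^sub>0 'a)"
      by (simp add: mon_mult)
    show ?case
      using snoc rderiv_p[of "g * mon w"] rderiv_s[of "g * mon w"] rderiv_q[of "g * mon w"] unfolding *
      by (cases a) (simp_all add: rderiv_s rderiv_p right_diff_distrib mult.assoc)
  qed
qed (intro is_lin_intros)+

fun ract_gen :: "gen \<Rightarrow> (gen list \<Rightarrow>\<^sub>0 'k::field) \<Rightarrow> (gen list \<Rightarrow>\<^sub>0 'k)" where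
  "ract_gen Gp x = rderiv x"
| "ract_gen g x = x * mon [g]"

text \<open>\<open>fold\<close> applies the first letter first, so this is a right action. Both
  relations hold for it: d(xs) + x = d(x) s and d(d(x) q) = d(x). The element rho(w) is
  \<open>ract 1 (mon w)\<close>.\<close>

definition ract :: "(gen list \<Rightarrow>\<^sub>0 'k::field) \<Rightarrow> (gen list \<Rightarrow>\<^sub>0 'k) \<Rightarrow> (gen list \<Rightarrow>\<^sub>0 'k)" where
  "ract f = lin_ext (\<lambda>w. fold ract_gen w f)"

lemma ract_mon: "ract f (mon w) = fold ract_gen w f"
  by (simp add: ract_def)

lemma is_lin_ract_gen: "is_lin T \<Longrightarrow> is_lin (\<lambda>f. ract_gen g (T f))"
  by (cases g) (simp_all add: is_lin_intros)

lemma is_lin_ract [is_lin_intros]: "is_lin T \<Longrightarrow> is_lin (\<lambda>x. ract f (T x))"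
  unfolding ract_def by (rule is_lin_lin_ext)

lemma is_lin_fold_ract: "is_lin T \<Longrightarrow> is_lin (\<lambda>f. fold ract_gen w (T f))"
proof (induction w arbitrary: T)
  case (Cons g w)
  from Cons.IH[OF is_lin_ract_gen[OF Cons.prems]] show ?case by simp
qed simp

lemma ract_mon_mult: "ract f (mon w * x) = ract (ract f (mon w)) x"
  by (rule is_lin_eq[where x = x]) (auto intro!: is_lin_intros simp: mon_mult ract_mon)

lemma ract_0 [simp]: "ract 0 x = 0"
proof (rule is_lin_eq[where x = x])
  show "is_lin (\<lambda>x. 0)" by (simp add: is_lin_def)
  show "ract 0 (mon w) = 0" for w
    using is_lin_zero[OF is_lin_fold_ract[OF is_lin_id]] by (simp add: ract_mon)
qed (intro is_lin_intros)

text \<open>The letters s and q act by right multiplication, which commutes with left multiplication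
  by g; the letter p acts by d, and \<open>rderiv_mult\<close> applies.\<close>

lemma ract_mult:
  assumes "rderiv g = 0"
  shows "ract (g * h) x = g * ract h x"
proof (rule is_lin_eq[where x = x])
  show "ract (g * h) (mon w) = g * ract h (mon w)" for w
  proof (induction w arbitrary: h)
    case (Cons a w)
    then show ?case
      by (cases a) (simp_all add: ract_mon rderiv_mult[OF assms] mult.assoc)
  qed (simp add: ract_mon)
qed (intro is_lin_intros)+

section \<open>Words without p under the right action\<close>

abbreviation pfree :: "gen list set" where
  "pfree \<equiv> {w. Gp \<notin> set w}"

lemma keys_mult_mon_pfree:
  "Poly_Mapping.keys x \<subseteq> pfree \<Longrightarrow> Gp \<notin> set u \<Longrightarrow> Poly_Mapping.keys (x * mon u) \<subseteq> pfree"
  using keys_mult_mon[of x u] by fastforce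

lemma keys_deriv_rev: "Gp \<notin> set w \<Longrightarrow> Poly_Mapping.keys (deriv_rev w :: _ \<Rightarrow>\<^sub>0 'k::field) \<subseteq> pfree"
proof (induction w rule: deriv_rev.induct)
  case (3 u)
  then have "Poly_Mapping.keys (deriv_rev u * mon [Gs] :: _ \<Rightarrow>\<^sub>0 'k) \<subseteq> pfree"
    by (intro keys_mult_mon_pfree) simp_all
  moreover have "Poly_Mapping.keys (mon (rev u) :: _ \<Rightarrow>\<^sub>0 'k) \<subseteq> pfree"
    using 3 by simp
  ultimately show ?case
    unfolding deriv_rev.simps by (rule keys_subset_diff)
qed simp_all

lemma keys_rderiv:
  fixes x :: "gen list \<Rightarrow>\<^sub>0 'k::field"
  shows "Poly_Mapping.keys x \<subseteq> pfree \<Longrightarrow> Poly_Mapping.keys (rderiv x) \<subseteq> pfree"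
proof (erule is_lin_keys_subset)
  show "Poly_Mapping.keys (rderiv (mon w) :: _ \<Rightarrow>\<^sub>0 'k) \<subseteq> pfree" if "w \<in> pfree" for w
    using that keys_deriv_rev[of "rev w"] by (simp add: rderiv_def)
qed (intro is_lin_intros)

lemma keys_fold_ract:
  "Poly_Mapping.keys f \<subseteq> pfree \<Longrightarrow> Poly_Mapping.keys (fold ract_gen w f) \<subseteq> pfree"
proof (induction w arbitrary: f)
  case (Cons g w)
  have "Poly_Mapping.keys (ract_gen g f) \<subseteq> pfree"
    using keys_rderiv[OF Cons.prems] keys_mult_mon_pfree[OF Cons.prems, of "[g]"]
    by (cases g) simp_all
  then show ?case
    using Cons.IH by simp
qed simp

text \<open>The letter p is consumed by d, which creates no p in a p-free element, and s and q are
  merely appended; starting from 1, no p can appear.\<close>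

lemma keys_ract_1:
  fixes x :: "gen list \<Rightarrow>\<^sub>0 'k::field"
  shows "Poly_Mapping.keys (ract 1 x) \<subseteq> pfree"
proof (rule is_lin_keys_subset[OF subset_UNIV, where T = "ract 1"])
  show "Poly_Mapping.keys (ract 1 (mon w) :: _ \<Rightarrow>\<^sub>0 'k) \<subseteq> pfree" for w
    unfolding ract_mon by (rule keys_fold_ract) (simp add: zero_list_def)
qed (intro is_lin_intros)

lemma ract_pfree:
  assumes "Poly_Mapping.keys x \<subseteq> pfree"
  shows "ract f x = f * x"
proof (rule is_lin_eq_on[OF assms])
  show "ract f (mon w) = f * mon w" if "w \<in> pfree" for w
    using that
  proof (induction w arbitrary: f)
    case Nil
    then show ?case by (simp only: ract_mon) (simp add: mon_Nil)
  next
    case (Cons g w)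
    then have "ract (ract_gen g f) (mon w) = ract_gen g f * mon w" "ract_gen g f = f * mon [g]"
      by (cases g; simp)+
    then show ?case
      by (simp add: ract_mon mult.assoc mon_mult)
  qed
qed (intro is_lin_intros)+

section \<open>The left module structure\<close>

text \<open>The operator P on words. The clause for s is ps = sp + 1, the one for q is pqw = w -
  rho(w) + pq rho(w); before a p or the empty word, p is just prepended.\<close>

fun lp_word :: "gen list \<Rightarrow> (gen list \<Rightarrow>\<^sub>0 'k::field)" where
  "lp_word [] = mon [Gp]"
| "lp_word (Gp # w) = mon (Gp # Gp # w)"
| "lp_word (Gs # w) = mon [Gs] * lp_word w + mon w"
| "lp_word (Gq # w) = mon w - ract 1 (mon w) + mon [Gp, Gq] * ract 1 (mon w)"

definition lp :: "(gen list \<Rightarrow>\<^sub>0 'k::field) \<Rightarrow> (gen list \<Rightarrow>\<^sub>0 'k)" where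
  "lp = lin_ext lp_word"

lemma lp_mon: "lp (mon w) = lp_word w"
  by (simp add: lp_def)

lemma is_lin_lp [is_lin_intros]: "is_lin T \<Longrightarrow> is_lin (\<lambda>x. lp (T x))"
  unfolding lp_def by (rule is_lin_lin_ext)

lemma lp_s: "lp (mon [Gs] * x) = mon [Gs] * lp x + x"
  by (rule is_lin_eq[where x = x]) (auto intro!: is_lin_intros simp: mon_mult lp_mon)

lemma lp_q: "lp (mon [Gq] * x) = x - ract 1 x + mon [Gp, Gq] * ract 1 x"
  by (rule is_lin_eq[where x = x]) (auto intro!: is_lin_intros simp: mon_mult lp_mon)

text \<open>The clauses of P mirror identities valid in the right action, so every f sees P(x) as p
  followed by x. For f = 1 this gives rho(P(x)) = 0, because d(1) = 0.\<close>

lemma ract_lp: "ract f (lp x) = ract (rderiv f) x"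
proof (rule is_lin_eq[where x = x])
  show "ract f (lp (mon w)) = ract (rderiv f) (mon w)" for w
  proof (induction w arbitrary: f rule: lp_word.induct)
    case (3 w)
    have "ract f (lp (mon (Gs # w))) = ract (f * mon [Gs]) (lp (mon w)) + ract f (mon w)"
      by (simp add: lp_mon is_lin_add[OF is_lin_ract[OF is_lin_id]] ract_mon_mult)
        (simp add: ract_mon)
    also have "\<dots> = ract (rderiv f * mon [Gs] - f) (mon w) + ract f (mon w)"
      by (simp add: 3 rderiv_s)
    also have "\<dots> = ract (rderiv f * mon [Gs]) (mon w)"
      by (simp add: ract_mon is_lin_diff[OF is_lin_fold_ract[OF is_lin_id]])
    finally show ?case
      by (simp add: ract_mon)
  next
    case (4 w)
    \<comment> \<open>The splitting f = g + d(f) q has d(g) = 0, since d(d(f) q) = d(f). On g the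
      word w therefore acts as multiplication by rho(w).\<close>
    define g where "g = f - rderiv f * mon [Gq]"
    have "rderiv g = 0"
      by (simp add: g_def is_lin_diff[OF is_lin_rderiv_id])
    then have "ract g (mon w) = g * ract 1 (mon w)"
      using ract_mult[of g 1] by simp
    moreover have "ract g (mon w) = ract f (mon w) - ract (rderiv f * mon [Gq]) (mon w)"
      by (simp add: g_def ract_mon is_lin_diff[OF is_lin_fold_ract[OF is_lin_id]])
    moreover have "ract f (lp (mon (Gq # w))) =
        ract f (mon w) - f * ract 1 (mon w) + rderiv f * mon [Gq] * ract 1 (mon w)"
    proof -
      have "ract f (mon [Gp, Gq] * ract 1 (mon w)) = rderiv f * mon [Gq] * ract 1 (mon w)"
        by (simp add: ract_mon_mult ract_pfree[OF keys_ract_1]) (simp add: ract_mon)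
      then show ?thesis
        by (simp add: lp_mon is_lin_add[OF is_lin_ract[OF is_lin_id]]
            is_lin_diff[OF is_lin_ract[OF is_lin_id]] ract_pfree[OF keys_ract_1])
    qed
    moreover have "rderiv f * mon [Gq] * ract 1 (mon w) = f * ract 1 (mon w) - g * ract 1 (mon w)"
      by (simp add: g_def left_diff_distrib)
    \<comment> \<open>With f.w for \<open>ract f (mon w)\<close>, the value is f.w - g rho(w) = f.w
      - g.w, which is the action of w on d(f) q.\<close>
    ultimately have "ract f (lp (mon (Gq # w))) = ract (rderiv f * mon [Gq]) (mon w)"
      by (simp add: diff_eq_eq add.commute)
    then show ?case
      by (simp add: ract_mon)
  qed (simp_all add: lp_mon ract_mon)
qed (intro is_lin_intros)+

text \<open>Since rho(P(x)) = 0 by \<open>ract_lp\<close>, both correction terms in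
  \<open>lp_q\<close> vanish. This is the relation pqp = p for P.\<close>

lemma lp_q_lp: "lp (mon [Gq] * lp x) = lp x"
  by (simp add: lp_q ract_lp)

section \<open>The action of R' and the normal form map\<close>

fun lact_gen :: "gen \<Rightarrow> (gen list \<Rightarrow>\<^sub>0 'k::field) \<Rightarrow> (gen list \<Rightarrow>\<^sub>0 'k)" where
  "lact_gen Gp x = lp x"
| "lact_gen g x = mon [g] * x"

definition lact :: "(gen list \<Rightarrow>\<^sub>0 'k::field) \<Rightarrow> (gen list \<Rightarrow>\<^sub>0 'k) \<Rightarrow> (gen list \<Rightarrow>\<^sub>0 'k)" where
  "lact x z = lin_ext (\<lambda>w. foldr lact_gen w z) x"

lemma lact_mon: "lact (mon w) z = foldr lact_gen w z"
  by (simp add: lact_def)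

lemma is_lin_lact_left [is_lin_intros]: "is_lin T \<Longrightarrow> is_lin (\<lambda>x. lact (T x) z)"
  unfolding lact_def by (rule is_lin_lin_ext)

lemma is_lin_lact_gen: "is_lin T \<Longrightarrow> is_lin (\<lambda>f. lact_gen g (T f))"
  by (cases g) (simp_all add: is_lin_intros)

lemma is_lin_foldr_lact: "is_lin (foldr lact_gen w)"
  by (induction w) (simp_all add: is_lin_intros is_lin_lact_gen id_def o_def)

lemmas is_lin_lact_left_id = is_lin_lact_left[OF is_lin_id]

lemma lact_mult: "lact (x * y) z = lact x (lact y z)"
proof (rule is_lin_eq[where x = y])
  fix v
  show "lact (x * mon v) z = lact x (lact (mon v) z)"
    by (rule is_lin_eq[where x = x]) (auto intro!: is_lin_intros simp: mon_mult lact_mon)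
next
  \<comment> \<open>\<open>lin_ext\<close> gives linearity in the acting element only. Linearity in
    the vector follows by writing x as a sum of scaled words, each acting as a composite of linear
    operators.\<close>
  show "is_lin (\<lambda>y. lact x (lact y z))"
  proof (induction x rule: word_poly_induct)
    case zero
    then show ?case
      by (simp add: is_lin_zero[OF is_lin_lact_left_id]) (simp add: is_lin_def)
  next
    case (add w c x)
    have "is_lin (\<lambda>y. lact (Poly_Mapping.single w c) (lact y z))"
      unfolding single_eq_mon[of w c] is_lin_scalar[OF is_lin_lact_left_id] lact_mon
      by (intro is_lin_mult_left is_lin_comp[OF is_lin_foldr_lact] is_lin_intros)
    with add show ?case
      by (simp add: is_lin_add[OF is_lin_lact_left_id] is_lin_plus)
  qed
qed (intro is_lin_intros)

lemma lact_zero_right: "lact x 0 = 0"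
proof (rule is_lin_eq[where x = x])
  show "is_lin (\<lambda>x. 0)" by (simp add: is_lin_def)
qed (auto intro!: is_lin_intros simp: lact_mon is_lin_zero[OF is_lin_foldr_lact])

lemma lact_rel_ideal:
  assumes "x \<in> rel_ideal"
  shows "lact x z = 0"
proof -
  \<comment> \<open>The annihilator of the module is a two-sided ideal; it contains the relators by
    \<open>lp_s\<close> and \<open>lp_q_lp\<close>, hence the ideal they generate.\<close>
  define I where "I = {x :: gen list \<Rightarrow>\<^sub>0 'a. \<forall>z. lact x z = 0}"
  have "two_sided_ideal I"
    unfolding two_sided_ideal_def I_def
    by (simp add: is_lin_zero[OF is_lin_lact_left_id] is_lin_add[OF is_lin_lact_left_id]
        lact_mult lact_zero_right)
  moreover have "rels \<subseteq> I"
    unfolding rels_def I_def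
    by (simp add: is_lin_add[OF is_lin_lact_left_id] is_lin_diff[OF is_lin_lact_left_id]
        lact_mon lp_s lp_q_lp mon_Nil[symmetric])
  ultimately have "rel_ideal \<subseteq> I"
    unfolding rel_ideal_def by (intro hull_minimal)
  with assms show ?thesis
    unfolding I_def by blast
qed

text \<open>Acting on 1 reproduces every basis word, so this map reads off coordinates.\<close>

lift_definition nf :: "'k::field ralg \<Rightarrow> (gen list \<Rightarrow>\<^sub>0 'k)" is "\<lambda>x. lact x 1"
  unfolding rel_cong_def
  by (metis lact_rel_ideal is_lin_diff[OF is_lin_lact_left_id] right_minus_eq)

lemma nf_add: "nf (x + y) = nf x + nf y"
  by transfer (rule is_lin_add[OF is_lin_lact_left_id])

lemma nf_scale: "nf (ralg_scale c x) = Poly_Mapping.single 0 c * nf x"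
  by transfer (simp add: map_mult_eq is_lin_scalar[OF is_lin_lact_left_id])

section \<open>Normal words\<close>

text \<open>A q right after a p closes the run of p's, so the rest must be p-free.\<close>

fun normal :: "gen list \<Rightarrow> bool" where
  "normal [] = True"
| "normal (Gs # w) = normal w"
| "normal (Gq # w) = normal w"
| "normal [Gp] = True"
| "normal (Gp # Gp # w) = normal (Gp # w)"
| "normal (Gp # Gs # w) = False"
| "normal (Gp # Gq # w) = (Gp \<notin> set w)"

lemma normal_pfree: "Gp \<notin> set w \<Longrightarrow> normal w"
  by (induction w rule: normal.induct) auto

lemma normal_Cons: "g \<noteq> Gp \<Longrightarrow> normal (g # w) = normal w"
  by (cases g) auto

lemma normal_ConsD: "normal (g # w) \<Longrightarrow> normal w"
  by (induction "g # w" arbitrary: g w rule: normal.induct) (auto intro: normal_pfree)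

lemma not_normal_ps: "\<not> normal (u @ Gp # Gs # v)"
  by (induction u rule: normal.induct) auto

text \<open>Letting v be empty or start with q excludes the factor ps at the end of the run. A
  p-free word is covered by b = 0 and empty v.\<close>

lemma normal_iff:
  "normal w \<longleftrightarrow> (\<exists>u b v. w = u @ replicate b Gp @ v \<and> Gp \<notin> set u \<and> Gp \<notin> set v \<and> (v = [] \<or> hd v = Gq))"
proof
  assume "normal w"
  then show "\<exists>u b v. w = u @ replicate b Gp @ v \<and> Gp \<notin> set u \<and> Gp \<notin> set v \<and> (v = [] \<or> hd v = Gq)"
  proof (induction w rule: normal.induct)
    case 1
    show ?case
      by (intro exI[of _ "[]"] exI[of _ 0]) simp
  next
    case (2 w)
    then obtain u b v where "w = u @ replicate b Gp @ v" "Gp \<notin> set u" "Gp \<notin> set v" "v = [] \<or> hd v = Gq"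
      by auto
    then show ?case
      by (intro exI[of _ "Gs # u"] exI[of _ b] exI[of _ v]) simp
  next
    case (3 w)
    then obtain u b v where "w = u @ replicate b Gp @ v" "Gp \<notin> set u" "Gp \<notin> set v" "v = [] \<or> hd v = Gq"
      by auto
    then show ?case
      by (intro exI[of _ "Gq # u"] exI[of _ b] exI[of _ v]) simp
  next
    case 4
    show ?case
      by (intro exI[of _ "[]"] exI[of _ 1]) simp
  next
    case (5 w)
    then obtain u b v where *: "Gp # w = u @ replicate b Gp @ v" "Gp \<notin> set u" "Gp \<notin> set v" "v = [] \<or> hd v = Gq"
      by auto
    then have "u = []"
      by (cases u) auto
    with * show ?case
      by (intro exI[of _ "[]"] exI[of _ "Suc b"] exI[of _ v]) simp
  next
    case (7 w)
    then show ?case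
      by (intro exI[of _ "[]"] exI[of _ 1] exI[of _ "Gq # w"]) simp
  qed simp
next
  assume "\<exists>u b v. w = u @ replicate b Gp @ v \<and> Gp \<notin> set u \<and> Gp \<notin> set v \<and> (v = [] \<or> hd v = Gq)"
  then obtain u b v where w: "w = u @ replicate b Gp @ v"
    and u: "Gp \<notin> set u" and v: "Gp \<notin> set v" "v = [] \<or> hd v = Gq"
    by blast
  have "normal (Gp # v)"
    using v by (cases v) auto
  then have "normal (replicate (Suc b) Gp @ v)" for b
    by (induction b) auto
  then have "normal (replicate b Gp @ v)"
    using normal_pfree[OF v(1)] by (cases b) auto
  then show "normal w"
    using u unfolding w by (induction u) (auto simp: normal_Cons)
qed

lemma basis_words_eq: "basis_words = {w. normal w}"
proof (intro set_eqI iffI)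
  fix w
  assume "w \<in> basis_words"
  then obtain u b v where w: "w = u @ replicate b Gp @ v" "Gp \<notin> set u" "Gp \<notin> set v"
    and ps: "\<nexists>u v. w = u @ [Gp, Gs] @ v"
    unfolding basis_words_def by blast
  have "normal w"
  \<comment> \<open>For b = 0 the tail v may begin with s, but then w is p-free. If b > 0, a leading
    s of v would follow the last p of the run and form the forbidden factor ps.\<close>
  proof (cases "b = 0 \<or> v = []")
    case True
    then show ?thesis
      using w normal_pfree[of w] unfolding normal_iff[of w] by fastforce
  next
    case False
    have "hd v \<noteq> Gs"
    proof
      assume "hd v = Gs"
      with False have "w = (u @ replicate (b - 1) Gp) @ [Gp, Gs] @ tl v"
        using w(1) by (cases b; cases v) (auto simp: replicate_append_same)
      with ps show False by blast
    qed
    then have "hd v = Gq"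
      using False w(3) by (cases v; cases "hd v") auto
    then show ?thesis
      using w unfolding normal_iff by blast
  qed
  then show "w \<in> {w. normal w}" by simp
next
  fix w
  assume "w \<in> {w. normal w}"
  then show "w \<in> basis_words"
    using not_normal_ps normal_iff[of w] unfolding basis_words_def by auto
qed

section \<open>Exponent form of the basis words\<close>

definition q_blocks :: "nat list \<Rightarrow> gen list" where
  "q_blocks ks = concat (map (\<lambda>k. Gq # replicate k Gs) ks)"

lemma q_blocks_append: "q_blocks (ks @ ls) = q_blocks ks @ q_blocks ls"
  by (simp add: q_blocks_def)

lemma q_blocks_map: "concat (map (\<lambda>i. Gq # replicate (a i) Gs) is) = q_blocks (map a is)"
  by (simp add: q_blocks_def o_def)

lemma pfree_q_blocks: "Gp \<notin> set (q_blocks ks)"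
  by (auto simp: q_blocks_def)

text \<open>Cut before every q. In the induction a new s lengthens the initial run, and a new q
  turns that run into the first block.\<close>

lemma pfreeE:
  assumes "Gp \<notin> set w"
  obtains k ks where "w = replicate k Gs @ q_blocks ks"
  using assms
proof (induction w arbitrary: thesis)
  case Nil
  show ?case by (rule Nil.prems(1)[of 0 "[]"]) (simp add: q_blocks_def)
next
  case (Cons g w)
  from Cons.prems(2) obtain k ks where w: "w = replicate k Gs @ q_blocks ks"
    using Cons.IH by auto
  consider "g = Gs" | "g = Gq"
    using Cons.prems(2) by (cases g) auto
  then show ?case
  proof cases
    case 1
    then show ?thesis
      using Cons.prems(1)[of "Suc k" ks] w by simp
  next
    case 2
    then show ?thesis
      using Cons.prems(1)[of 0 "k # ks"] w by (simp add: q_blocks_def)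
  qed
qed

lemma form_word_q_blocks:
  "form_word a m n b =
     replicate (a 0) Gs @ q_blocks (map a [1..<m + 1]) @ replicate b Gp @ q_blocks (map a [m + 1..<n + 1])"
  by (simp only: form_word_def q_blocks_map)

lemma basis_words_form: "basis_words = {form_word a m n b | a m n b. m \<le> n}"
proof (intro set_eqI iffI)
  fix w
  assume "w \<in> basis_words"
  then obtain u b v where w: "w = u @ replicate b Gp @ v"
    and u: "Gp \<notin> set u" and v: "Gp \<notin> set v" "v = [] \<or> hd v = Gq"
    unfolding basis_words_eq normal_iff by blast
  obtain k ks where ks: "u = replicate k Gs @ q_blocks ks"
    using pfreeE[OF u] .
  obtain l ls where "v = replicate l Gs @ q_blocks ls"
    using pfreeE[OF v(1)] .
  with v(2) have ls: "v = q_blocks ls"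
    by (cases l) (auto simp: q_blocks_def)
  \<comment> \<open>Index 0 holds the initial run of s; the entries of \<open>ks\<close> then occupy
    1 to m and those of \<open>ls\<close> m + 1 to n, with m = \<open>length ks\<close> and n =
    \<open>length ks + length ls\<close>.\<close>
  define a where "a = (!) (k # ks @ ls)"
  have "map a [1..<length ks + 1] = ks"
    by (rule nth_equalityI) (auto simp: a_def nth_append simp del: upt_Suc)
  moreover have "map a [length ks + 1..<length ks + length ls + 1] = ls"
    by (rule nth_equalityI) (auto simp: a_def nth_append simp del: upt_Suc)
  ultimately have "w = form_word a (length ks) (length ks + length ls) b"
    unfolding form_word_q_blocks w ks ls by (simp add: a_def)
  then show "w \<in> {form_word a m n b | a m n b. m \<le> n}"
    by fastforce
next
  fix w
  assume "w \<in> {form_word a m n b | a m n b. m \<le> n}"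
  then obtain a m n b where w: "w = form_word a m n b" by blast
  let ?v = "q_blocks (map a [m + 1..<n + 1])"
  have "w = (replicate (a 0) Gs @ q_blocks (map a [1..<m + 1])) @ replicate b Gp @ ?v"
    unfolding w form_word_q_blocks by simp
  moreover have "?v = [] \<or> hd ?v = Gq"
    by (cases "map a [m + 1..<n + 1]") (auto simp: q_blocks_def)
  ultimately show "w \<in> basis_words"
    unfolding basis_words_eq mem_Collect_eq normal_iff
    by (metis Un_iff pfree_q_blocks gen.distinct(1) in_set_replicate set_append)
qed

text \<open>Without p's between them, the two lists of blocks join into one list over 1 to n, so m
  disappears.\<close>

lemma form_word_0:
  assumes "m \<le> n"
  shows "form_word a m n 0 = replicate (a 0) Gs @ q_blocks (map a [1..<n + 1])"
proof -
  have "[1..<n + 1] = [1..<m + 1] @ [m + 1..<n + 1]"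
    using upt_add_eq_append[of 1 "m + 1" "n - m"] assms by simp
  then show ?thesis
    unfolding form_word_q_blocks by (simp add: q_blocks_append del: upt_Suc)
qed

section \<open>Linear independence\<close>

lemma lp_1: "lp 1 = mon [Gp]"
  by (simp add: mon_Nil[symmetric] lp_mon)

lemma nf_0: "nf 0 = 0"
  using nf_add[of 0 0] by simp

lemma nf_word:
  assumes "normal w"
  shows "nf (ralg_word w) = (mon w :: _ \<Rightarrow>\<^sub>0 'k::field)"
proof -
  have "foldr lact_gen w 1 = (mon w :: _ \<Rightarrow>\<^sub>0 'k)"
    using assms
  proof (induction w)
    case Nil
    then show ?case by (simp add: mon_Nil)
  next
    case (Cons g w)
    note IH = Cons.IH[OF normal_ConsD[OF Cons.prems]]
    show ?case
    proof (cases "g = Gp")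
      case True
      \<comment> \<open>Normality excludes a tail starting with s. If the tail is qv, then v is
        p-free, so rho(v) = v and the formula for P(qv) collapses to pqv.\<close>
      with Cons.prems IH show ?thesis
        by (cases w rule: lp_word.cases) (simp_all add: lp_1 lp_mon ract_pfree mon_mult)
    next
      case False
      with IH show ?thesis
        by (cases g) (simp_all add: mon_mult)
    qed
  qed
  then show ?thesis
    by (simp add: ralg_word_eq nf.abs_eq lact_mon)
qed

lemma inj_on_ralg_word: "inj_on ralg_word basis_words"
proof (rule inj_onI)
  fix u v :: "gen list"
  assume "u \<in> basis_words" "v \<in> basis_words" "(ralg_word u :: 'k::field ralg) = ralg_word v"
  then have "(mon u :: _ \<Rightarrow>\<^sub>0 'k) = mon v"
    using nf_word by (metis basis_words_eq mem_Collect_eq)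
  then show "u = v"
    using keys_mon[where 'k = 'k] by (metis singleton_inject)
qed

text \<open>\<open>nf\<close> turns a relation between basis words into one between distinct
  monomials of the free algebra; the coefficient at a single word isolates each scalar.\<close>

lemma independent_ralg_word:
  "ralg.independent ((ralg_word :: gen list \<Rightarrow> 'k::field ralg) ` basis_words)"
  unfolding ralg.independent_explicit_module
proof (intro allI impI)
  fix t :: "'k ralg set" and c x
  assume t: "finite t" "t \<subseteq> ralg_word ` basis_words" "(\<Sum>v\<in>t. ralg_scale (c v) v) = 0" "x \<in> t"
  obtain w where w: "x = ralg_word w" "normal w"
    using t by (auto simp: basis_words_eq)
  have nf_sum: "nf (\<Sum>v\<in>t. f v) = (\<Sum>v\<in>t. nf (f v))" for f :: "'k ralg \<Rightarrow> 'k ralg"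
    by (intro sum_comp_morphism[unfolded o_def, symmetric]) (simp_all add: nf_0 nf_add)
  have "Poly_Mapping.lookup (nf (ralg_scale (c v) v)) w = (if v = x then c v else 0)" if v: "v \<in> t" for v
  proof -
    obtain u where u: "v = ralg_word u" "normal u"
      using v t by (auto simp: basis_words_eq)
    have "v = x \<longleftrightarrow> u = w"
      using inj_on_ralg_word[where 'a = 'k] u w by (auto simp: basis_words_eq inj_on_def)
    moreover have "nf (ralg_scale (c v) v) = Poly_Mapping.single u (c v)"
      using u by (simp add: nf_scale nf_word single_eq_mon[symmetric])
    ultimately show ?thesis
      by (simp add: lookup_single when_def)
  qed
  then have "c x = (\<Sum>v\<in>t. Poly_Mapping.lookup (nf (ralg_scale (c v) v)) w)"
    using t by simp
  also have "\<dots> = Poly_Mapping.lookup (nf (\<Sum>v\<in>t. ralg_scale (c v) v)) w"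
    by (simp add: nf_sum lookup_sum)
  also have "\<dots> = 0"
    using t by (simp add: nf_0)
  finally show "c x = 0" .
qed

section \<open>Spanning\<close>

abbreviation gp :: "'k::field ralg" where "gp \<equiv> ralg_gen Gp"
abbreviation gs :: "'k::field ralg" where "gs \<equiv> ralg_gen Gs"
abbreviation gq :: "'k::field ralg" where "gq \<equiv> ralg_gen Gq"

text \<open>As in the Weyl algebra, p differentiates powers of s: each of the n + 1 factors s that p
  passes contributes one s^n.\<close>

lemma gp_gs_power:
  "(gp :: 'k::field ralg) * gs ^ Suc n = gs ^ Suc n * gp + ralg_scale (of_nat (Suc n)) (gs ^ n)"
proof (induction n)
  case 0
  show ?case by (simp add: ralg_rel_ps)
next
  case (Suc n)
  have "(gp :: 'k ralg) * gs ^ Suc (Suc n) = (gp * gs) * gs ^ Suc n"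
    by (simp add: mult.assoc)
  also have "\<dots> = gs * (gp * gs ^ Suc n) + gs ^ Suc n"
    unfolding ralg_rel_ps by (simp add: distrib_right mult.assoc)
  also have "\<dots> = gs ^ Suc (Suc n) * gp + (ralg_scale (of_nat (Suc n)) (gs ^ Suc n) + gs ^ Suc n)"
    unfolding Suc by (simp add: distrib_left ralg_scale_mult_right mult.assoc add.assoc)
  also have "ralg_scale (of_nat (Suc n)) (gs ^ Suc n) + gs ^ Suc n =
      ralg_scale (of_nat (Suc (Suc n))) (gs ^ Suc n :: 'k ralg)"
    using ralg.scale_left_distrib[of 1 "of_nat (Suc n)" "gs ^ Suc n :: 'k ralg"]
    by (simp add: add.commute del: power_Suc)
  finally show ?case .
qed

text \<open>The extra power s^k carries the induction on the last letter of v: a last s is absorbed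
  by it, and for a last q or p a factor s is traded against a factor p.\<close>

lemma corner_zero_power:
  "(1 - gp * gq) * ralg_word v * gs ^ k * (1 - gq * gp) = (0 :: 'k::field_char_0 ralg)"
proof (induction v arbitrary: k rule: rev_induct)
  let ?e = "1 - gp * gq :: 'k ralg" and ?f = "1 - gq * gp :: 'k ralg"
  have ep: "?e * gp = 0" and pf: "gp * ?f = 0"
    by (simp_all add: left_diff_distrib right_diff_distrib ralg_rel_pqp mult.assoc[symmetric])
  \<comment> \<open>Multiplying p s^(k+1) = s^(k+1) p + (k+1) s^k by 1 - qp on the right kills the
    term s^(k+1) p; characteristic 0 permits division by k + 1.\<close>
  have power: "x * gs ^ k * ?f = ralg_scale (1 / of_nat (Suc k)) (x * gp * gs ^ Suc k * ?f)" for x k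
  proof -
    have "x * gp * gs ^ Suc k * ?f = x * (gp * gs ^ Suc k) * ?f"
      by (simp only: mult.assoc)
    also have "\<dots> = x * gs ^ Suc k * (gp * ?f) + ralg_scale (of_nat (Suc k)) (x * gs ^ k * ?f)"
      unfolding gp_gs_power
      by (simp only: distrib_left distrib_right ralg_scale_mult_left ralg_scale_mult_right mult.assoc)
    finally show ?thesis
      unfolding pf by (simp del: of_nat_Suc)
  qed
  {
    case Nil
    show ?case
      using power[of ?e k] by (simp add: ralg_word_def ep)
  next
    case (snoc g v)
    have v: "ralg_word (v @ [h]) = ralg_word v * (ralg_gen h :: 'k ralg)" for h
      by (simp add: ralg_word_def)
    show ?case
    proof (cases g)
      case Gs
      then show ?thesis
        using snoc[of "Suc k"] by (simp add: v mult.assoc)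
    next
      case Gq
      \<comment> \<open>Writing qp = 1 - (1 - qp) yields two terms, which vanish by the induction
        hypothesis for the exponents k + 1 and 0.\<close>
      have "?e * ralg_word v * gq * gp * gs ^ Suc k * ?f =
          ?e * ralg_word v * gs ^ Suc k * ?f - ?e * ralg_word v * gs ^ 0 * ?f * (gs ^ Suc k * ?f)"
        by (simp add: left_diff_distrib right_diff_distrib mult.assoc)
      then have "?e * ralg_word v * gq * gp * gs ^ Suc k * ?f = 0"
        unfolding snoc by simp
      then have "?e * ralg_word v * gq * gs ^ k * ?f = 0"
        using power[of "?e * ralg_word v * gq" k] by simp
      then show ?thesis
        by (simp add: v Gq mult.assoc)
    next
      case Gp
      show ?thesis
      proof (cases k)
        case 0
        then show ?thesis
          by (simp add: v Gp mult.assoc pf)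
      next
        case (Suc j)
        \<comment> \<open>Here \<open>power\<close> is read backwards: the left side vanishes by the
          induction hypothesis, and the right side is a nonzero multiple of the goal.\<close>
        then have "?e * ralg_word v * gs ^ j * ?f =
            ralg_scale (1 / of_nat k) (?e * ralg_word v * gp * gs ^ k * ?f)"
          using power[of "?e * ralg_word v" j] by simp
        then show ?thesis
          using snoc[of j] Suc by (simp add: v Gp mult.assoc del: of_nat_Suc)
      qed
    qed
  }
qed

lemma corner_zero: "(1 - gp * gq) * ralg_word v * (1 - gq * gp) = (0 :: 'k::field_char_0 ralg)"
  using corner_zero_power[of v 0] by simp

section \<open>Right multiplication by p on (1 - pq) R'\<close>

lemma abs_ralg_add: "abs_ralg (x + y) = abs_ralg x + abs_ralg y"
  by (simp add: plus_ralg.abs_eq)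

lemma abs_ralg_diff: "abs_ralg (x - y) = abs_ralg x - abs_ralg y"
  by (simp add: minus_ralg.abs_eq)

lemma abs_ralg_mult: "abs_ralg (x * y) = abs_ralg x * abs_ralg y"
  by (simp add: times_ralg.abs_eq)

lemma abs_ralg_0: "abs_ralg 0 = 0"
  by (simp add: zero_ralg_def)

lemma abs_ralg_scalar: "abs_ralg (Poly_Mapping.single 0 c * x) = ralg_scale c (abs_ralg x)"
  by (simp add: ralg_scale.abs_eq map_mult_eq)

lemma abs_ralg_mon_Cons: "abs_ralg (mon (g # w)) = ralg_gen g * abs_ralg (mon w)"
  by (simp add: ralg_word_eq[symmetric] ralg_word_def)

lemma abs_ralg_mon_Nil: "abs_ralg (mon []) = 1"
  by (simp add: ralg_word_eq[symmetric] ralg_word_def)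

lemmas abs_ralg_simps = abs_ralg_add abs_ralg_diff abs_ralg_mult abs_ralg_0 abs_ralg_scalar
  abs_ralg_mon_Cons abs_ralg_mon_Nil

text \<open>The rules of d hold in (1 - pq) R': (1 - pq) p = 0 for the empty word, sp = ps - 1 for a
  last s, and the corner identity lets qp act as 1 for a last q.\<close>

lemma corner_rderiv:
  "(1 - gp * gq) * abs_ralg x * gp = (1 - gp * gq) * abs_ralg (rderiv x :: _ \<Rightarrow>\<^sub>0 'k::field_char_0)"
proof -
  let ?e = "1 - gp * gq :: 'k ralg"
  have word: "?e * abs_ralg (mon w) * gp = ?e * abs_ralg (rderiv (mon w))" for w
  proof (induction w rule: rev_induct)
    case Nil
    then show ?case
      by (simp add: mon_Nil abs_ralg_0 one_ralg_def[symmetric] left_diff_distrib ralg_rel_pqp)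
  next
    case (snoc g w)
    have w: "mon (w @ [g]) = mon w * (mon [g] :: _ \<Rightarrow>\<^sub>0 'k)"
      by (simp add: mon_mult)
    show ?case
    proof (cases g)
      case Gp
      then show ?thesis
        unfolding w using snoc by (simp add: rderiv_p abs_ralg_simps mult.assoc[symmetric])
    next
      case Gs
      have "?e * abs_ralg (mon w) * gs * gp = ?e * abs_ralg (mon w) * gp * gs - ?e * abs_ralg (mon w)"
        by (simp add: mult.assoc ralg_rel_ps distrib_left)
      then show ?thesis
        unfolding w unfolding Gs using snoc
        by (simp add: rderiv_s abs_ralg_simps right_diff_distrib mult.assoc[symmetric])
    next
      case Gq
      then show ?thesis
        unfolding w using corner_zero[of w, where 'k = 'k]
        by (simp add: abs_ralg_simps right_diff_distrib ralg_word_eq mult.assoc)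
    qed
  qed
  show ?thesis
  proof (induction x rule: keys_subset_induct[OF subset_UNIV])
    case 1
    then show ?case
      by (simp add: abs_ralg_0 is_lin_zero[OF is_lin_rderiv_id])
  next
    case (2 w c y)
    then show ?case
      by (simp add: abs_ralg_add abs_ralg_scalar is_lin_add[OF is_lin_rderiv_id]
          is_lin_scalar[OF is_lin_rderiv_id] distrib_left distrib_right
          ralg_scale_mult_left ralg_scale_mult_right word)
  qed
qed

lemma corner_ract:
  "(1 - gp * gq) * abs_ralg (fold ract_gen w x :: _ \<Rightarrow>\<^sub>0 'k::field_char_0) =
   (1 - gp * gq) * abs_ralg x * abs_ralg (mon w)"
proof (induction w arbitrary: x)
  case Nil
  show ?case by (simp add: abs_ralg_mon_Nil)
next
  case (Cons g w)
  have "(1 - gp * gq) * abs_ralg (ract_gen g x) = (1 - gp * gq) * abs_ralg x * (ralg_gen g :: 'k ralg)"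
    by (cases g) (simp_all add: corner_rderiv[symmetric] abs_ralg_simps mult.assoc)
  then show ?case
    by (simp add: Cons.IH abs_ralg_mon_Cons mult.assoc)
qed

text \<open>For a leading q, \<open>corner_ract\<close> at x = 1 gives (1 - pq) rho(w) = (1 - pq) w,
  which rearranges to the clause of \<open>lp_word\<close>.\<close>

lemma gp_mult_word: "gp * abs_ralg (mon w) = abs_ralg (lp_word w :: _ \<Rightarrow>\<^sub>0 'k::field_char_0)"
proof (induction w rule: lp_word.induct)
  case (3 w)
  have "gp * abs_ralg (mon (Gs # w)) = ( gs * (gp * abs_ralg (mon w)) + abs_ralg (mon w) :: 'k ralg)"
    by (simp add: abs_ralg_mon_Cons mult.assoc[symmetric] ralg_rel_ps distrib_right)
  with 3 show ?case
    by (simp add: abs_ralg_simps)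
next
  case (4 w)
  have "(1 - gp * gq) * abs_ralg (ract 1 (mon w)) = (1 - gp * gq) * abs_ralg (mon w :: _ \<Rightarrow>\<^sub>0 'k)"
    by (simp add: ract_mon corner_ract one_ralg_def[symmetric])
  then show ?case
    by (simp add: abs_ralg_simps left_diff_distrib mult.assoc algebra_simps)
qed (simp_all add: abs_ralg_simps)

section \<open>Straightening into basis words\<close>

lemma keys_lp_word:
  "normal w \<Longrightarrow> Poly_Mapping.keys (lp_word w :: _ \<Rightarrow>\<^sub>0 'k::field) \<subseteq> {w. normal w}"
proof (induction w rule: lp_word.induct)
  case (3 w)
  have "Poly_Mapping.keys (mon [Gs] * lp_word w :: _ \<Rightarrow>\<^sub>0 'k) \<subseteq> {w. normal w}"
    using 3 keys_mon_mult[of "[Gs]" "lp_word w :: _ \<Rightarrow>\<^sub>0 'k"] by fastforce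
  with 3 show ?case
    by (simp add: keys_subset_add)
next
  case (4 w)
  \<comment> \<open>Since rho(w) is p-free, prefixing pq leaves a single p, followed by q.\<close>
  have ract: "Poly_Mapping.keys (ract 1 (mon w) :: _ \<Rightarrow>\<^sub>0 'k) \<subseteq> pfree"
    by (rule keys_ract_1)
  then have "Poly_Mapping.keys (mon [Gp, Gq] * ract 1 (mon w) :: _ \<Rightarrow>\<^sub>0 'k) \<subseteq> {w. normal w}"
    using keys_mon_mult[of "[Gp, Gq]" "ract 1 (mon w) :: _ \<Rightarrow>\<^sub>0 'k"] by fastforce
  moreover have "Poly_Mapping.keys (ract 1 (mon w) :: _ \<Rightarrow>\<^sub>0 'k) \<subseteq> {w. normal w}"
    using ract normal_pfree by blast
  ultimately show ?case
    using 4 by (simp add: keys_subset_add keys_subset_diff)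
qed simp_all

lemma abs_ralg_in_span:
  assumes "Poly_Mapping.keys x \<subseteq> S"
  shows "abs_ralg x \<in> ralg.span (ralg_word ` S)"
  using assms
proof (induction x rule: keys_subset_induct)
  case zero
  show ?case by (simp add: abs_ralg_0 ralg.span_zero)
next
  case (add w c y)
  then show ?case
    unfolding abs_ralg_add abs_ralg_scalar ralg_word_eq[symmetric]
    by (intro ralg.span_add ralg.span_scale) (auto intro: ralg.span_base)
qed

text \<open>The span contains 1 and is closed under left multiplication by each generator, for p by
  the straightening formula; hence it contains every word.\<close>

lemma span_ralg_word:
  "ralg.span ((ralg_word :: gen list \<Rightarrow> 'k::field_char_0 ralg) ` basis_words) = UNIV"
proof -
  let ?W = "ralg.span ((ralg_word :: gen list \<Rightarrow> 'k ralg) ` basis_words)"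
  have gen_word: "ralg_gen g * ralg_word w \<in> ?W" if "normal w" for g w
  proof (cases "g = Gp")
    case True
    then show ?thesis
      using abs_ralg_in_span[OF keys_lp_word[OF that], where 'a = 'k]
      by (simp add: ralg_word_eq gp_mult_word basis_words_eq)
  next
    case False
    then have "ralg_word (g # w) \<in> ?W"
      using that by (intro ralg.span_base imageI) (simp add: basis_words_eq normal_Cons)
    then show ?thesis
      by (simp add: ralg_word_def)
  qed
  have gen: "ralg_gen g * x \<in> ?W" if "x \<in> ?W" for g x
    using that
  proof (induction x rule: ralg.span_induct_alt)
    case base
    show ?case by (simp add: ralg.span_zero)
  next
    case (step c x y)
    then show ?case
      using gen_word
      by (auto simp: distrib_left ralg_scale_mult_right basis_words_eq
          intro!: ralg.span_add ralg.span_scale)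
  qed
  have "ralg_word w \<in> ?W" for w
  proof (induction w)
    case Nil
    show ?case
      by (intro ralg.span_base imageI) (simp add: basis_words_eq)
  next
    case (Cons g w)
    then show ?case
      using gen by (simp add: ralg_word_def)
  qed
  then have "ralg.span (range ralg_word) \<subseteq> ?W"
    by (intro ralg.span_minimal ralg.subspace_span) auto
  moreover have "x \<in> ralg.span (range ralg_word)" for x :: "'k ralg"
    by (induction x rule: ralg.abs_induct) (rule abs_ralg_in_span[OF subset_UNIV])
  ultimately show ?thesis
    by blast
qed

theorem theorem17:
  shows "inj_on (ralg_word :: gen list \<Rightarrow> 'k::field_char_0 ralg) basis_words
    \<and> ralg.independent ((ralg_word :: gen list \<Rightarrow> 'k ralg) ` basis_words)
    \<and> ralg.span ((ralg_word :: gen list \<Rightarrow> 'k ralg) ` basis_words) = UNIV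
    \<and> basis_words = {form_word a m n b | a m n b. m \<le> n}
    \<and> (\<forall>a m m' n. m \<le> n \<longrightarrow> m' \<le> n \<longrightarrow> form_word a m n 0 = form_word a m' n 0)"
  by (intro conjI inj_on_ralg_word independent_ralg_word span_ralg_word basis_words_form)
    (metis form_word_0)

end
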